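(* Let $\mathcal{X}\subset\mathbb{R}^n$ be compact and let $\alpha\in[0,1]$ be a violation level such that $\mathcal{X}_\alpha\neq\emptyset$. Suppose that $\mathsf{Pr}_\xi\{\xi\in\mathsf{supp}\,p:\bar h(x,\xi)=0\}=0$ for each $x\in\mathcal{X}$. Then $A_\alpha\neq\emptyset$; that is, there exists a Borel probability measure $\mu^*$ on $\mathcal{X}$ with $\int_{\mathcal{X}}\mathbb{P}(x)\,d\mu^*\ge 1-\alpha$ and $\int_{\mathcal{X}}J(x)\,d\mu^*=\mathcal{J}^*_\alpha$.
   Context: Setting: $J:\mathcal{X}\to\mathbb{R}$ is continuous. $\xi$ is a random variable with values in $\Xi\subseteq\mathbb{R}^s$ having a continuous probability density $p$ with support $\Xi$; $\mathsf{Pr}_\xi$ denotes its law, and $\mathsf{supp}\,p$ is the closure of $\{\xi\in\Xi:p(\xi)>0\}$. $h=(h_1,\dots,h_m):\mathcal{X}\times\Xi\to\mathbb{R}^m$ is continuous, and $\bar h(x,\xi):=\max_{i=1,\dots,m}h_i(x,\xi)$. With $\mathbb{I}\{y\}=1$ if $y\le 0$ and $\mathbb{I}\{y\}=0$ otherwise, $\mathbb{P}(x):=\int_{\Xi}\mathbb{I}\{\bar h(x,\xi)\}p(\xi)\,d\xi$, i.e. the probability that $\bar h(x,\xi)\le 0$. Put $\mathcal{X}_\alpha:=\{x\in\mathcal{X}:\mathbb{P}(x)\ge 1-\alpha\}$. $M(\mathcal{X})$ is the set of all Borel probability measures on $\mathcal{X}$, $M_\alpha(\mathcal{X}):=\{\mu\in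 M(\mathcal{X}):\int_{\mathcal{X}}\mathbb{P}(x)\,d\mu\ge 1-\alpha\}$, $\mathcal{J}^*_\alpha:=\inf_{\mu\in M_\alpha(\mathcal{X})}\int_{\mathcal{X}}J(x)\,d\mu$, and $A_\alpha:=\{\mu\in M_\alpha(\mathcal{X}):\int_{\mathcal{X}}J(x)\,d\mu=\mathcal{J}^*_\alpha\}$. *)

theory Defs
  imports "HOL-Probability.Probability"
begin

definition ind_le0 :: "real \<Rightarrow> real" where
  "ind_le0 y = (if y \<le> 0 then 1 else 0)"

definition hbar :: "('x \<Rightarrow> 'y \<Rightarrow> real ^ 'm) \<Rightarrow> 'x \<Rightarrow> 'y \<Rightarrow> real" where
  "hbar h x z = (MAX i\<in>UNIV. h x z $ i)"

(* A density is only given on Xi: the values of p outside Xi are irrelevant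
   here and in all definitions below. *)
definition supp_density :: "'y::topological_space set \<Rightarrow> ('y \<Rightarrow> real) \<Rightarrow> 'y set" where
  "supp_density Xi p = closure {z \<in> Xi. p z > 0}"

definition sat_prob ::
  "'y::euclidean_space set \<Rightarrow> ('y \<Rightarrow> real) \<Rightarrow> ('x \<Rightarrow> 'y \<Rightarrow> real ^ 'm) \<Rightarrow> 'x \<Rightarrow> real" where
  "sat_prob Xi p h x = (LINT z:Xi|lborel. ind_le0 (hbar h x z) * p z)"

(* In the following definitions P stands for the map sat_prob Xi p h. *)

definition feasible_points :: "'x set \<Rightarrow> ('x \<Rightarrow> real) \<Rightarrow> real \<Rightarrow> 'x set" where
  "feasible_points X P \<alpha> = {x \<in> X. P x \<ge> 1 - \<alpha>}"

(* The condition on the sets entails space \<mu> = X. *)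
definition borel_prob_measures :: "'x::topological_space set \<Rightarrow> 'x measure set" where
  "borel_prob_measures X = {\<mu>. prob_space \<mu> \<and> sets \<mu> = sets (restrict_space borel X)}"

definition feasible_measures ::
  "'x::topological_space set \<Rightarrow> ('x \<Rightarrow> real) \<Rightarrow> real \<Rightarrow> 'x measure set" where
  "feasible_measures X P \<alpha> = {\<mu> \<in> borel_prob_measures X. (\<integral>x. P x \<partial>\<mu>) \<ge> 1 - \<alpha>}"

(* A real infimum: it is only meaningful when there is a feasible measure and the
   objective values are bounded below, e.g. for J continuous on a compact X. *)
definition opt_value ::
  "'x::topological_space set \<Rightarrow> ('x \<Rightarrow> real) \<Rightarrow> ('x \<Rightarrow> real) \<Rightarrow> real \<Rightarrow> real" where
  "opt_value X J P \<alpha> = (INF \<mu>\<in>feasible_measures X P \<alpha>. (\<integral>x. J x \<partial>\<mu>))"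

definition opt_measures ::
  "'x::topological_space set \<Rightarrow> ('x \<Rightarrow> real) \<Rightarrow> ('x \<Rightarrow> real) \<Rightarrow> real \<Rightarrow> 'x measure set" where
  "opt_measures X J P \<alpha> =
    {\<mu> \<in> feasible_measures X P \<alpha>. (\<integral>x. J x \<partial>\<mu>) = opt_value X J P \<alpha>}"

end

theory Submission
  imports Defs
begin

text \<open>
  The infinite-dimensional problem over measures is really a problem in the plane. The objective and
  the constraint see a probability measure \<open>\<mu>\<close> only through the pair
  \<open>(\<integral>J d\<mu>, \<integral>P d\<mu>)\<close>, the mean of the map \<open>f = (J, P)\<close> on \<open>X\<close>. If \<open>f\<close> is continuous, the means of
  \<open>f\<close> under all Borel probability measures on the compact set \<open>X\<close> are exactly the points of
  \<open>convex hull (f ` X)\<close> (\<open>integral_in_convex_hull_image\<close>, \<open>convex_hull_image_attained\<close>). This hull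
  is a compact subset of the plane, hence so is its part in the half plane where the second
  coordinate is at least \<open>1 - \<alpha>\<close>, and the first coordinate attains its minimum there. A point of
  the hull is a finite convex combination of values of \<open>f\<close>, so a minimiser comes from a measure of
  finite support (\<open>opt_measures_nonempty\<close>).

  It remains to see that the satisfaction probability is continuous on \<open>X\<close>. When \<open>x'\<close> tends to
  \<open>x\<close>, the indicator of \<open>hbar h x' z \<le> 0\<close> can only fail to converge to that of
  \<open>hbar h x z \<le> 0\<close> at points \<open>z\<close> with \<open>hbar h x z = 0\<close>. Such points carry no probability, so the
  density vanishes almost everywhere on them, and dominated convergence with the density as the
  majorant applies (\<open>continuous_on_sat_prob\<close>).
\<close>

section \<open>Means of a continuous map under Borel probability measures\<close>

lemma space_borel_prob_measures:
  assumes "\<mu> \<in> borel_prob_measures X"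
  shows "space \<mu> = X"
proof -
  have "sets \<mu> = sets (restrict_space borel X)"
    using assms by (simp add: borel_prob_measures_def)
  from sets_eq_imp_space_eq[OF this] show ?thesis
    by (simp add: space_restrict_space)
qed

lemma borel_measurable_borel_prob_measures:
  assumes "\<mu> \<in> borel_prob_measures X" and "continuous_on X f"
  shows "f \<in> borel_measurable \<mu>"
proof -
  have "sets \<mu> = sets (restrict_space borel X)"
    using assms(1) by (simp add: borel_prob_measures_def)
  then show ?thesis
    by (subst measurable_cong_sets[OF _ refl])
      (auto intro: borel_measurable_continuous_on_restrict[OF assms(2)])
qed

lemma integrable_borel_prob_measures:
  fixes f :: "'x::topological_space \<Rightarrow> 'b::euclidean_space"
  assumes "compact X" and "continuous_on X f" and "\<mu> \<in> borel_prob_measures X"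
  shows "integrable \<mu> f"
proof -
  interpret prob_space \<mu> using assms(3) by (simp add: borel_prob_measures_def)
  have "bounded (f ` X)"
    by (intro compact_imp_bounded compact_continuous_image assms)
  then obtain B where "\<And>x. x \<in> X \<Longrightarrow> norm (f x) \<le> B"
    unfolding bounded_iff by blast
  then have "AE x in \<mu>. norm (f x) \<le> B"
    by (intro AE_I2) (simp only: space_borel_prob_measures[OF assms(3)])
  then show ?thesis
    by (rule integrable_const_bound) (rule borel_measurable_borel_prob_measures[OF assms(3,2)])
qed

text \<open>
  Every closed half space containing \<open>f ` X\<close> contains the mean of \<open>f\<close>, because integration against
  a probability measure preserves linear inequalities; and a compact convex hull is the
  intersection of such half spaces.
\<close>

lemma integral_in_convex_hull_image:
  fixes f :: "'x::topological_space \<Rightarrow> 'b::euclidean_space"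
  assumes "compact X" and "continuous_on X f" and "\<mu> \<in> borel_prob_measures X"
  shows "(\<integral>x. f x \<partial>\<mu>) \<in> convex hull (f ` X)"
proof (rule ccontr)
  assume out: "(\<integral>x. f x \<partial>\<mu>) \<notin> convex hull (f ` X)"
  interpret prob_space \<mu> using assms(3) by (simp add: borel_prob_measures_def)
  have int: "integrable \<mu> f"
    by (rule integrable_borel_prob_measures[OF assms])
  have "closed (convex hull (f ` X))"
    by (intro compact_imp_closed compact_convex_hull compact_continuous_image assms)
  from separating_hyperplane_closed_point[OF convex_convex_hull this out]
  obtain a b where ab: "a \<bullet> (\<integral>x. f x \<partial>\<mu>) < b" "\<And>y. y \<in> convex hull (f ` X) \<Longrightarrow> b < a \<bullet> y"
    by blast
  have "b \<le> a \<bullet> f x" if "x \<in> space \<mu>" for x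
  proof -
    have "f x \<in> convex hull (f ` X)"
      using that space_borel_prob_measures[OF assms(3)] by (intro hull_inc) blast
    then show ?thesis by (rule less_imp_le[OF ab(2)])
  qed
  then have "b \<le> (\<integral>x. a \<bullet> f x \<partial>\<mu>)"
    using int by (intro integral_ge_const AE_I2 integrable_inner_right)
  also have "\<dots> = a \<bullet> (\<integral>x. f x \<partial>\<mu>)"
    using int by simp
  finally show False using ab(1) by simp
qed

lemma convex_hull_image_attained:
  fixes f :: "'x::topological_space \<Rightarrow> 'b::euclidean_space"
  assumes "continuous_on X f" and "y \<in> convex hull (f ` X)"
  obtains \<mu> where "\<mu> \<in> borel_prob_measures X" and "(\<integral>x. f x \<partial>\<mu>) = y"
proof -
  obtain S u where S: "finite S" "S \<subseteq> f ` X" "\<And>v. v \<in> S \<Longrightarrow> 0 \<le> u v" "sum u S = 1"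
    and y: "(\<Sum>v\<in>S. u v *\<^sub>R v) = y"
    using assms(2)[unfolded convex_hull_explicit mem_Collect_eq]
    by (elim exE conjE) (rule that, simp_all)
  define g where "g = inv_into X f"
  have g: "g v \<in> X" "f (g v) = v" if "v \<in> S" for v
    using that S(2) by (auto simp: g_def inv_into_into f_inv_into_f)
  \<comment> \<open>the discrete measure that puts weight \<open>u v\<close> on one chosen preimage of each \<open>v\<close>\<close>
  define \<mu> where "\<mu> = distr (point_measure S u) (restrict_space borel X) g"
  have meas: "g \<in> measurable (point_measure S u) (restrict_space borel X)"
    using g(1) by (auto simp: point_measure_def space_restrict_space)
  have "prob_space \<mu>"
    unfolding \<mu>_def
    by (intro prob_space.prob_space_distr prob_space_point_measure meas)
      (use S in \<open>auto simp: sum_ennreal\<close>)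
  then have "\<mu> \<in> borel_prob_measures X"
    by (simp add: borel_prob_measures_def \<mu>_def)
  moreover have "(\<integral>x. f x \<partial>\<mu>) = (\<integral>v. f (g v) \<partial>point_measure S u)"
    unfolding \<mu>_def
    by (rule integral_distr[OF meas borel_measurable_continuous_on_restrict[OF assms(1)]])
  then have "(\<integral>x. f x \<partial>\<mu>) = y"
    using S g(2) y by (simp add: lebesgue_integral_point_measure_finite)
  ultimately show thesis by (rule that)
qed

section \<open>Existence of optimal measures for continuous data\<close>

text \<open>
  The feasible objective values are the first coordinates of the compact planar set \<open>C\<close> below; its
  nonemptiness is where a feasible point enters.
\<close>

lemma opt_measures_nonempty:
  fixes X :: "'x::topological_space set" and J P :: "'x \<Rightarrow> real"
  assumes X: "compact X" and J: "continuous_on X J" and P: "continuous_on X P"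
    and "feasible_points X P \<alpha> \<noteq> {}"
  shows "opt_measures X J P \<alpha> \<noteq> {}"
proof -
  define f where "f = (\<lambda>x. (J x, P x))"
  have f: "continuous_on X f"
    unfolding f_def by (intro continuous_intros J P)
  have mean: "(\<integral>x. f x \<partial>\<mu>) = (\<integral>x. J x \<partial>\<mu>, \<integral>x. P x \<partial>\<mu>)" if "\<mu> \<in> borel_prob_measures X" for \<mu>
    using integral_bounded_linear[OF bounded_linear_fst integrable_borel_prob_measures[OF X f that]]
      integral_bounded_linear[OF bounded_linear_snd integrable_borel_prob_measures[OF X f that]]
    by (simp add: f_def prod_eq_iff)
  define C where "C = convex hull (f ` X) \<inter> {y. 1 - \<alpha> \<le> snd y}"
  have "compact C"
    unfolding C_def
    by (intro compact_Int_closed compact_convex_hull compact_continuous_image X f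
        closed_Collect_le continuous_intros)
  moreover have "C \<noteq> {}"
  proof -
    obtain x where "x \<in> X" "1 - \<alpha> \<le> P x"
      using assms(4) by (auto simp: feasible_points_def)
    then have "f x \<in> C"
      by (auto simp: C_def f_def intro: hull_inc)
    then show ?thesis by blast
  qed
  ultimately obtain c where c: "c \<in> C" "\<And>y. y \<in> C \<Longrightarrow> fst c \<le> fst y"
    using continuous_attains_inf[of C fst] continuous_on_fst[OF continuous_on_id] by blast
  obtain \<mu> where \<mu>: "\<mu> \<in> borel_prob_measures X" "(\<integral>x. f x \<partial>\<mu>) = c"
    using convex_hull_image_attained[OF f] c(1) unfolding C_def by blast
  then have val: "fst c = (\<integral>x. J x \<partial>\<mu>)"
    using mean by auto
  have feas: "\<mu> \<in> feasible_measures X P \<alpha>"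
    using \<mu> mean c(1) by (auto simp: feasible_measures_def C_def)
  have "(\<integral>x. J x \<partial>\<mu>) \<le> (\<integral>x. J x \<partial>\<nu>)" if "\<nu> \<in> feasible_measures X P \<alpha>" for \<nu>
  proof -
    have \<nu>: "\<nu> \<in> borel_prob_measures X" "1 - \<alpha> \<le> (\<integral>x. P x \<partial>\<nu>)"
      using that by (auto simp: feasible_measures_def)
    then have "(\<integral>x. f x \<partial>\<nu>) \<in> C"
      using integral_in_convex_hull_image[OF X f \<nu>(1)] mean by (simp add: C_def)
    then show ?thesis
      using c(2) val mean[OF \<nu>(1)] by fastforce
  qed
  then have "opt_value X J P \<alpha> = (\<integral>x. J x \<partial>\<mu>)"
    unfolding opt_value_def using feas by (intro cInf_eq_minimum) auto
  then show ?thesis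
    using feas by (auto simp: opt_measures_def)
qed

section \<open>Continuity of the satisfaction probability\<close>

lemma continuous_on_Max_image:
  fixes f :: "'i \<Rightarrow> 'a::topological_space \<Rightarrow> 'b::linorder_topology"
  assumes "finite I" and "I \<noteq> {}" and "\<And>i. i \<in> I \<Longrightarrow> continuous_on S (f i)"
  shows "continuous_on S (\<lambda>x. MAX i\<in>I. f i x)"
  using assms by (induction I rule: finite_ne_induct) (auto intro!: continuous_on_max)

lemma continuous_on_hbar:
  fixes h :: "'x::topological_space \<Rightarrow> 'y::topological_space \<Rightarrow> real ^ 'm"
  assumes "continuous_on (X \<times> Xi) (\<lambda>(x, z). h x z)"
  shows "x \<in> X \<Longrightarrow> continuous_on Xi (hbar h x)"
    and "z \<in> Xi \<Longrightarrow> continuous_on X (\<lambda>x. hbar h x z)"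
proof -
  have "continuous_on (X \<times> Xi) (\<lambda>w. MAX i\<in>UNIV. (case w of (x, z) \<Rightarrow> h x z) $ i)"
    by (intro continuous_on_Max_image continuous_on_component assms) auto
  then have *: "continuous_on (X \<times> Xi) (\<lambda>w. hbar h (fst w) (snd w))"
    by (simp add: hbar_def case_prod_unfold)
  show "continuous_on Xi (hbar h x)" if "x \<in> X"
  proof -
    have "continuous_on Xi (\<lambda>z. (x, z))" "(\<lambda>z. (x, z)) ` Xi \<subseteq> X \<times> Xi"
      using that by (auto intro: continuous_on_Pair[OF continuous_on_const continuous_on_id])
    from continuous_on_compose2[OF * this] show ?thesis by simp
  qed
  show "continuous_on X (\<lambda>x. hbar h x z)" if "z \<in> Xi"
  proof -
    have "continuous_on X (\<lambda>x. (x, z))" "(\<lambda>x. (x, z)) ` X \<subseteq> X \<times> Xi"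
      using that by (auto intro: continuous_on_Pair[OF continuous_on_id continuous_on_const])
    from continuous_on_compose2[OF * this] show ?thesis by simp
  qed
qed

lemma borel_measurable_ind_le0: "ind_le0 \<in> borel_measurable borel"
  unfolding ind_le0_def by measurable

text \<open>The function \<open>ind_le0\<close> is locally constant away from its jump at \<open>0\<close>.\<close>

lemma tendsto_ind_le0:
  assumes "(f \<longlongrightarrow> l) F" and "l \<noteq> 0"
  shows "((\<lambda>n. ind_le0 (f n)) \<longlongrightarrow> ind_le0 l) F"
proof (rule tendsto_eventually)
  show "\<forall>\<^sub>F n in F. ind_le0 (f n) = ind_le0 l"
  proof (cases "l < 0")
    case True
    from order_tendstoD(2)[OF assms(1) True] show ?thesis
      by eventually_elim (use True in \<open>simp add: ind_le0_def\<close>)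
  next
    case False
    then have pos: "0 < l" using assms(2) by simp
    from order_tendstoD(1)[OF assms(1) pos] show ?thesis
      by eventually_elim (use pos in \<open>simp add: ind_le0_def\<close>)
  qed
qed

lemma continuous_on_sat_prob:
  fixes X :: "'x::{first_countable_topology, t2_space} set" and Xi :: "'y::euclidean_space set"
  assumes Xi: "closed Xi" and p: "continuous_on Xi p" and int: "set_integrable lborel Xi p"
    and h: "continuous_on (X \<times> Xi) (\<lambda>(x, z). h x z)"
    and null: "\<And>x. x \<in> X \<Longrightarrow> AE z in lborel. z \<in> Xi \<longrightarrow> hbar h x z = 0 \<longrightarrow> p z = 0"
  shows "continuous_on X (sat_prob Xi p h)"
proof (rule continuous_on_sequentiallyI)
  fix a x assume a: "\<forall>n. a n \<in> X" and x: "x \<in> X" and lim: "a \<longlonglongrightarrow> x"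
  define F where "F y z = indicator Xi z *\<^sub>R (ind_le0 (hbar h y z) * p z)" for y z
  have sat: "sat_prob Xi p h y = (\<integral>z. F y z \<partial>lborel)" for y
    by (simp add: sat_prob_def set_lebesgue_integral_def F_def)
  have meas: "F y \<in> borel_measurable lborel" if "y \<in> X" for y
  proof -
    have "(\<lambda>z. ind_le0 (hbar h y z) * p z) \<in> borel_measurable (restrict_space borel Xi)"
      by (intro borel_measurable_times borel_measurable_continuous_on_restrict p
          measurable_compose[OF _ borel_measurable_ind_le0] continuous_on_hbar(1)[OF h that])
    then have "F y \<in> borel_measurable borel"
      using Xi unfolding F_def
      by (subst (asm) borel_measurable_restrict_space_iff) auto
    then show ?thesis by simp
  qed
  show "(\<lambda>n. sat_prob Xi p h (a n)) \<longlonglongrightarrow> sat_prob Xi p h x"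
    unfolding sat
  proof (rule integral_dominated_convergence[where w = "\<lambda>z. norm (indicator Xi z *\<^sub>R p z)"])
    show "integrable lborel (\<lambda>z. norm (indicator Xi z *\<^sub>R p z))"
      using int unfolding set_integrable_def by (rule integrable_norm)
    show "AE z in lborel. (\<lambda>n. F (a n) z) \<longlonglongrightarrow> F x z"
      using null[OF x]
    proof eventually_elim
      case (elim z)
      show ?case
      proof (cases "z \<in> Xi \<and> hbar h x z \<noteq> 0")
        case True
        then have "(\<lambda>n. hbar h (a n) z) \<longlonglongrightarrow> hbar h x z"
          using continuous_on_hbar(2)[OF h, of z] a x lim
          by (auto simp: continuous_on_sequentially o_def)
        then show ?thesis
          unfolding F_def using True by (intro tendsto_intros tendsto_ind_le0) auto
      next
        case False
        then show ?thesis using elim by (auto simp: F_def)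
      qed
    qed
    show "F x \<in> borel_measurable lborel" "F (a n) \<in> borel_measurable lborel" for n
      using meas x a by blast+
  qed (auto simp: F_def ind_le0_def)
qed

text \<open>
  A null set of the law of \<open>\<xi>\<close> may well have positive Lebesgue measure, but the density
  then vanishes at almost all of its points. That is enough for dominated convergence, whose integrands carry the factor \<open>p z\<close>.
\<close>

lemma distributed_null_set_density_zero:
  fixes \<xi> :: "'w \<Rightarrow> 'y::euclidean_space"
  assumes "prob_space \<Omega>"
    and dens: "distributed \<Omega> lborel \<xi> (\<lambda>z. ennreal (indicator Xi z * p z))"
    and nonneg: "\<And>z. z \<in> Xi \<Longrightarrow> 0 \<le> p z"
    and N: "N \<in> sets borel" and null: "measure (distr \<Omega> borel \<xi>) N = 0"
  shows "AE z in lborel. z \<in> Xi \<longrightarrow> z \<in> N \<longrightarrow> p z = 0"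
proof -
  interpret \<Omega>: prob_space \<Omega> by fact
  have \<xi>: "\<xi> \<in> measurable \<Omega> borel"
    using distributed_measurable[OF dens] by simp
  interpret D: prob_space "distr \<Omega> borel \<xi>"
    by (rule \<Omega>.prob_space_distr[OF \<xi>])
  have D: "distr \<Omega> borel \<xi> = density lborel (\<lambda>z. ennreal (indicator Xi z * p z))"
    using distributed_distr_eq_density[OF dens] by (simp cong: distr_cong)
  have "N \<in> null_sets (density lborel (\<lambda>z. ennreal (indicator Xi z * p z)))"
    using N null D.emeasure_eq_measure[of N] unfolding D by (auto simp: null_sets_def)
  then have "AE z in lborel. z \<in> N \<longrightarrow> ennreal (indicator Xi z * p z) = 0"
    using null_sets_density_iff[of _ lborel] distributed_borel_measurable[OF dens] by blast
  then show ?thesis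
    by eventually_elim (use nonneg in \<open>auto simp: ennreal_eq_0_iff intro: antisym\<close>)
qed

lemma distributed_density_set_integrable:
  fixes \<xi> :: "'w \<Rightarrow> 'y::euclidean_space"
  assumes "prob_space \<Omega>"
    and dens: "distributed \<Omega> lborel \<xi> (\<lambda>z. ennreal (indicator Xi z * p z))"
    and nonneg: "\<And>z. z \<in> Xi \<Longrightarrow> 0 \<le> p z"
    and meas: "set_borel_measurable lborel Xi p"
  shows "set_integrable lborel Xi p"
proof -
  interpret \<Omega>: prob_space \<Omega> by fact
  have "(\<integral>\<^sup>+z. ennreal (indicator Xi z * p z) \<partial>lborel) = 1"
    using distributed_nn_integral[OF dens, of "\<lambda>_. 1"] by (simp add: \<Omega>.emeasure_space_1)
  then show ?thesis
    unfolding set_integrable_def using meas nonneg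
    by (intro integrableI_nonneg) (auto simp: set_borel_measurable_def indicator_def)
qed

section \<open>Existence of an optimal measure for the chance-constrained problem\<close>

theorem theorem1:
  fixes X :: "(real ^ 'n) set"
    and Xi :: "(real ^ 's) set"
    and J :: "real ^ 'n \<Rightarrow> real"
    and h :: "real ^ 'n \<Rightarrow> real ^ 's \<Rightarrow> real ^ 'm"
    and p :: "real ^ 's \<Rightarrow> real"
    and \<Omega> :: "'w measure"
    and \<xi> :: "'w \<Rightarrow> real ^ 's"
    and \<alpha> :: real
  assumes "compact X"
    and "continuous_on X J"
    and "prob_space \<Omega>"
    and "\<And>\<omega>. \<omega> \<in> space \<Omega> \<Longrightarrow> \<xi> \<omega> \<in> Xi"
    and "\<And>z. z \<in> Xi \<Longrightarrow> p z \<ge> 0"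
    and "continuous_on Xi p"
    and "distributed \<Omega> lborel \<xi> (\<lambda>z. ennreal (indicator Xi z * p z))"
    and "supp_density Xi p = Xi"
    and "continuous_on (X \<times> Xi) (\<lambda>(x, z). h x z)"
    and "0 \<le> \<alpha>" and "\<alpha> \<le> 1"
    and "feasible_points X (sat_prob Xi p h) \<alpha> \<noteq> {}"
    and "\<And>x. x \<in> X \<Longrightarrow>
      measure (distr \<Omega> borel \<xi>) {z \<in> supp_density Xi p. hbar h x z = 0} = 0"
  shows "opt_measures X J (sat_prob Xi p h) \<alpha> \<noteq> {}"
proof -
  \<comment> \<open>a support is a closure\<close>
  have Xi: "closed Xi"
    using assms(8) by (metis supp_density_def closed_closure)
  have meas: "set_borel_measurable lborel Xi p"
    using borel_measurable_continuous_on_indicator[of Xi p] Xi assms(6)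
    by (simp add: set_borel_measurable_def)
  have null: "AE z in lborel. z \<in> Xi \<longrightarrow> hbar h x z = 0 \<longrightarrow> p z = 0" if x: "x \<in> X" for x
  proof -
    have "closed {z \<in> Xi. hbar h x z = 0}"
      by (rule continuous_closed_preimage_constant[OF continuous_on_hbar(1)[OF assms(9) x] Xi])
    moreover have "measure (distr \<Omega> borel \<xi>) {z \<in> Xi. hbar h x z = 0} = 0"
      using assms(13)[OF x] by (simp only: assms(8))
    ultimately have "AE z in lborel. z \<in> Xi \<longrightarrow> z \<in> {z \<in> Xi. hbar h x z = 0} \<longrightarrow> p z = 0"
      by (intro distributed_null_set_density_zero[OF assms(3,7,5)] borel_closed)
    then show ?thesis by eventually_elim auto
  qed
  have "continuous_on X (sat_prob Xi p h)"
    by (intro continuous_on_sat_prob Xi assms(6,9) null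
        distributed_density_set_integrable[OF assms(3,7,5) meas])
  then show ?thesis
    by (intro opt_measures_nonempty assms(1,2,12))
qed

end
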